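(* For $|q|<1$, $$\sum_{m,k,n\geq0} \frac{q^{2T(k)+2T(m+k)+2T(n)}}{(q)_m(q)_{2k+1}}\begin{bmatrix} k\\ n\end{bmatrix}_q=\frac{(q^{21},q^5,q^{16};q^{21})_\infty}{(q)_\infty}.$$
   Context: For $m$ a nonnegative integer, $(a)_m=(a;q)_m=\prod_{j=0}^{m-1}(1-aq^j)$ (with $(a)_0=1$), $(a;q)_\infty=\prod_{j\ge0}(1-aq^j)$, $(q)_\infty=(q;q)_\infty$, and $(a_1,\ldots,a_r;q)_\infty=(a_1;q)_\infty\cdots(a_r;q)_\infty$. In particular $(q)_m=\prod_{j=1}^m(1-q^j)$. The $q$-binomial coefficient is $\begin{bmatrix} m+n\\ m\end{bmatrix}_q=\frac{(q)_{m+n}}{(q)_m(q)_n}$ if $m,n$ are nonnegative integers, and it is $0$ otherwise (so $\begin{bmatrix} A\\ B\end{bmatrix}_q=0$ unless $0\le B\le A$). $T(j)=\frac{j(j+1)}{2}$. *)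

theory Defs
  imports "HOL-Analysis.Analysis"
begin

definition qpoch :: "complex \<Rightarrow> complex \<Rightarrow> nat \<Rightarrow> complex" where
  "qpoch a q m = (\<Prod>j<m. 1 - a * q ^ j)"

definition qpoch_inf :: "complex \<Rightarrow> complex \<Rightarrow> complex" where
  "qpoch_inf a q = (\<Prod>j. 1 - a * q ^ j)"

definition qpochs_inf :: "complex list \<Rightarrow> complex \<Rightarrow> complex" where
  "qpochs_inf as q = (\<Prod>a\<leftarrow>as. qpoch_inf a q)"

definition qbinom :: "complex \<Rightarrow> nat \<Rightarrow> nat \<Rightarrow> complex" where
  "qbinom q A B =
     (if B \<le> A then qpoch q q A / (qpoch q q B * qpoch q q (A - B)) else 0)"

definition T :: "nat \<Rightarrow> nat" where
  "T j = j * (j + 1) div 2"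

end

theory Submission
  imports Defs
begin

text \<open>
  The sum over n is a Rogers--Ramanujan polynomial, which Bressoud's finite identity rewrites as
  \<open>\<Sum>n. q^(n\<^sup>2 + n) [k, n] = \<Sum>j\<in>\<int>. (-1)^j q^(j (5 j + 3) / 2) [2 k + 1, k - 2 j]\<close>.
  Thus the summand becomes a Bailey pair relative to \<open>a = q\<close> supported on the indices \<open>r = 2 j\<close>.
  The sums over k and m are two applications of Bailey's lemma, each of which contributes a factor
  \<open>q^(r\<^sup>2 + r)\<close>, and what remains is \<open>\<Sum>j. (-1)^j q^((21 j\<^sup>2 + 11 j) / 2) / (q)\<^sub>\<infinity>\<close>, a case of
  Jacobi's triple product.
\<close>

section \<open>Reciprocal q-factorials\<close>

text \<open>With r = 2 j, the binomial [2 k + 1, k - 2 j] is, up to a factor depending on k alone,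
  the Bailey kernel \<open>qrec q (k - r) * qrec q (k + r + 1)\<close>. The kernel and
  \<open>r * r + r\<close> are both invariant under r -> -1 - r, which is why all integers j can be
  used: a negative even r stands for the odd index -1 - r of a one-sided Bailey pair.

  The recurrence in k for binomials with top 2 k + 1 brings in those with top 2 k, so Bressoud's
  identity is proved together with its companion.

  The constants: the quadratic coefficient 5/2 grows by 2 * 4, because r * r = 4 j * j enters twice,
  and gives 21/2. Written as 21 * \<open>choose2 j\<close> + 16 * j, the exponent shows the base
  q^21 and the parameter z = q^16 of Jacobi's product, whose partner is q^21 / z = q^5.

  Infinite identities are limits of finite ones under a summable majorant. Majorants are geometric
  in the natural indices and theta series in j. Negative powers of q occur throughout the sums over
  j, so q = 0 is treated apart.\<close>

text \<open>
  Setting \<open>1 / (q)\<^sub>n = 0\<close> for negative n makes \<open>1 / (q)\<^sub>n\<^sub>-\<^sub>1 = (1 - q^n) / (q)\<^sub>n\<close> valid for every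
  integer n, so that q-binomial recurrences need no boundary cases.
\<close>

definition qrec :: "complex \<Rightarrow> int \<Rightarrow> complex" where
  "qrec q n = (if n < 0 then 0 else 1 / qpoch q q (nat n))"

lemma qpoch_0 [simp]: "qpoch a q 0 = 1"
  by (simp add: qpoch_def)

lemma qpoch_Suc: "qpoch a q (Suc n) = qpoch a q n * (1 - a * q ^ n)"
  by (simp add: qpoch_def)

lemma one_minus_power_nonzero:
  fixes q :: complex
  assumes "norm q < 1"
  shows "1 - q * q ^ n \<noteq> 0"
proof
  assume "1 - q * q ^ n = 0"
  then have "norm (q ^ Suc n) = 1" by simp
  moreover have "norm (q ^ Suc n) < 1"
    using assms power_less_one_iff[of "norm q" "Suc n"] by (simp add: norm_power del: power_Suc)
  ultimately show False by linarith
qed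

lemma qpoch_nonzero:
  assumes "norm q < 1"
  shows "qpoch q q n \<noteq> 0"
  using one_minus_power_nonzero[OF assms] by (simp add: qpoch_def)

lemma qpoch_inf_convergent:
  fixes q :: complex
  assumes "norm q < 1"
  shows "convergent_prod (\<lambda>j. 1 - a * q ^ j)"
proof (rule abs_convergent_prod_imp_convergent_prod, rule summable_imp_abs_convergent_prod)
  show "summable (\<lambda>j. norm (1 - a * q ^ j - 1))"
    using assms by (simp add: norm_mult norm_power summable_mult summable_geometric)
qed

lemma qpoch_tendsto:
  assumes "norm q < 1"
  shows "(\<lambda>n. qpoch a q n) \<longlonglongrightarrow> qpoch_inf a q"
  using convergent_prod_LIMSEQ[OF qpoch_inf_convergent[OF assms, of a]]
  by (simp add: qpoch_def qpoch_inf_def LIMSEQ_lessThan_iff_atMost)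

lemma qpoch_inf_nonzero:
  assumes "norm q < 1"
  shows "qpoch_inf q q \<noteq> 0"
  unfolding qpoch_inf_def
  by (rule prodinf_nonzero[OF qpoch_inf_convergent[OF assms]])
     (rule one_minus_power_nonzero[OF assms])

lemma qrec_neg [simp]: "n < 0 \<Longrightarrow> qrec q n = 0"
  by (simp add: qrec_def)

lemma qrec_0 [simp]: "qrec q 0 = 1"
  by (simp add: qrec_def)

lemma qrec_of_nat: "qrec q (int n) = 1 / qpoch q q n"
  by (simp add: qrec_def)

lemma qrec_diff_1:
  assumes "norm q < 1"
  shows "qrec q (n - 1) = (1 - q powi n) * qrec q n"
proof (cases "n > 0")
  case True
  then obtain m where "n = int (Suc m)"
    using gr0_implies_Suc zero_less_imp_eq_int by (metis of_nat_0_less_iff)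
  then show ?thesis
    using one_minus_power_nonzero[OF assms, of m]
    by (simp add: qrec_def qpoch_Suc nat_add_distrib power_int_add_1 algebra_simps flip: power_int_of_nat)
       (simp add: power_int_def nat_add_distrib divide_simps algebra_simps)
next
  case False
  then show ?thesis by (cases "n = 0") (auto simp: qrec_def)
qed

lemma qrec_of_nat_pred:
  assumes "norm q < 1"
  shows "qrec q (int n) = (1 - q * q ^ n) * qrec q (int (Suc n))"
  using qrec_diff_1[OF assms, of "int (Suc n)"] by (simp add: power_int_def nat_add_distrib)

lemma qrec_tendsto:
  assumes "norm q < 1"
  shows "(\<lambda>n. qrec q (int n + c)) \<longlonglongrightarrow> 1 / qpoch_inf q q"
proof -
  have "(\<lambda>n. qrec q (int n)) \<longlonglongrightarrow> 1 / qpoch_inf q q"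
    unfolding qrec_of_nat
    by (intro tendsto_intros qpoch_tendsto qpoch_inf_nonzero assms)
  then have *: "filterlim (\<lambda>n. qrec q (int n)) (nhds (1 / qpoch_inf q q)) at_top" .
  have "filterlim (\<lambda>n. nat (int n + c)) at_top at_top"
    unfolding filterlim_at_top
  proof
    fix Z
    show "\<forall>\<^sub>F n in sequentially. Z \<le> nat (int n + c)"
      using eventually_ge_at_top[of "Z + nat (- c)"] by eventually_elim auto
  qed
  from filterlim_compose[OF * this]
  show ?thesis
  proof (rule Lim_transform_eventually)
    show "\<forall>\<^sub>F n in sequentially. qrec q (int (nat (int n + c))) = qrec q (int n + c)"
      using eventually_ge_at_top[of "nat (- c)"] by eventually_elim auto
  qed
qed

text \<open>The single constant serves as majorant for every reciprocal factorial, whatever its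
  integer argument, in the limits and exchanges of summation below.\<close>

lemma qrec_bounded:
  assumes "norm q < 1"
  obtains C where "C > 0" "\<And>n. norm (qrec q n) \<le> C"
proof -
  have "Bseq (\<lambda>n. qrec q (int n))"
    using qrec_tendsto[OF assms, of 0] by (intro convergent_imp_Bseq) (auto simp: convergent_def)
  then obtain C where C: "C > 0" "\<And>n. norm (qrec q (int n)) \<le> C"
    by (auto simp: Bseq_def)
  have "norm (qrec q n) \<le> C" for n
    using C(1) C(2)[of "nat n"] by (cases "n < 0") auto
  with C(1) that show thesis by blast
qed

text \<open>
  Splitting \<open>1 - q^(M+1) = (1 - q^i) + q^i (1 - q^(M+1-i))\<close> under the sum turns the case \<open>(M + 1, c)\<close>
  into \<open>(M, c + 1)\<close>.
\<close>

lemma q_vandermonde: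
  assumes "norm q < 1"
  shows "(\<Sum>i\<le>M. q ^ (i * (i + c)) * (qrec q (int (M - i)) * qrec q (int i) * qrec q (int (i + c))))
           = qrec q (int M) * qrec q (int (M + c))"
proof (induction M arbitrary: c)
  case 0
  show ?case by simp
next
  case (Suc M)
  note R = qrec_of_nat_pred[OF assms]
  let ?f = "\<lambda>i. q ^ (i * (i + c)) * (qrec q (int (Suc M - i)) * qrec q (int i) * qrec q (int (i + c)))"
  let ?a = "\<lambda>i. (1 - q ^ i) * ?f i"
  let ?b = "\<lambda>i. q ^ i * (1 - q ^ (Suc M - i)) * ?f i"
  have "(1 - q * q ^ M) * (\<Sum>i\<le>Suc M. ?f i) = (\<Sum>i\<le>Suc M. ?a i + ?b i)"
    unfolding sum_distrib_left
  proof (rule sum.cong[OF refl])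
    fix i assume "i \<in> {..Suc M}"
    then have "q * q ^ M = q ^ i * q ^ (Suc M - i)"
      by (simp flip: power_add power_Suc)
    then show "(1 - q * q ^ M) * ?f i = ?a i + ?b i"
      by (simp only: flip: distrib_right) (simp add: algebra_simps)
  qed
  also have "\<dots> = (\<Sum>i\<le>Suc M. ?a i) + (\<Sum>i\<le>Suc M. ?b i)"
    by (rule sum.distrib)
  \<comment> \<open>The factor 1 - q^0 kills the term i = 0 of \<open>?a\<close> and the term i = M
    + 1 of \<open>?b\<close>, so after one shift both sums run over i up to M.\<close>
  also have "(\<Sum>i\<le>Suc M. ?a i) = (\<Sum>i\<le>M. ?a (Suc i))"
    by (subst sum.atMost_Suc_shift) simp
  also have "(\<Sum>i\<le>Suc M. ?b i) = (\<Sum>i\<le>M. ?b i)"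
    by simp
  also have "(\<Sum>i\<le>M. ?a (Suc i)) + (\<Sum>i\<le>M. ?b i)
      = (\<Sum>i\<le>M. q ^ (i * (i + Suc c)) * (qrec q (int (M - i)) * qrec q (int i) * qrec q (int (i + Suc c))))"
    unfolding sum.distrib[symmetric]
  proof (rule sum.cong[OF refl])
    fix i assume i: "i \<in> {..M}"
    have 1: "qrec q (int (M - i)) = (1 - q ^ (Suc M - i)) * qrec q (int (Suc M - i))"
      using R[of "M - i"] i by (simp add: Suc_diff_le)
    have 2: "?a (Suc i) = q ^ (Suc i * (Suc i + c)) * (qrec q (int (M - i)) * qrec q (int i) * qrec q (int (Suc (i + c))))"
      by (simp only: R[of i] diff_Suc_Suc) (simp add: mult_ac)
    have 3: "?b i = q ^ (i * (i + Suc c)) * (qrec q (int (M - i)) * qrec q (int i) * ((1 - q ^ Suc (i + c)) * qrec q (int (Suc (i + c)))))"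
      by (simp only: 1 R[of "i + c"]) (simp add: power_add mult_ac)
    have 4: "q ^ (Suc i * (Suc i + c)) = q ^ (i * (i + Suc c)) * q ^ Suc (i + c)"
      by (simp flip: power_add power_Suc add: algebra_simps)
    show "?a (Suc i) + ?b i = q ^ (i * (i + Suc c)) * (qrec q (int (M - i)) * qrec q (int i) * qrec q (int (i + Suc c)))"
      unfolding 2 3 unfolding 4 by (simp add: algebra_simps)
  qed
  also have "\<dots> = qrec q (int M) * qrec q (int (M + Suc c))"
    by (rule Suc.IH)
  also have "\<dots> = (1 - q * q ^ M) * (qrec q (int (Suc M)) * qrec q (int (Suc M + c)))"
    using R[of M] by simp
  finally show ?case
    using one_minus_power_nonzero[OF assms, of M] by (simp only: mult_cancel_left) simp
qed

section \<open>Bailey's lemma\<close>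

text \<open>Tannery's theorem for unordered sums. The bijection \<open>e\<close> enumerates the
  index type so that the version for series applies; it will be the identity for naturals and
  \<open>int_decode\<close> for integers.\<close>

lemma has_sum_dominated_convergence:
  fixes f :: "nat \<Rightarrow> 'a \<Rightarrow> 'b::{real_normed_algebra, banach}" and e :: "nat \<Rightarrow> 'a"
  assumes e: "bij e"
    and f: "\<And>n. (f n has_sum S n) UNIV"
    and lim: "\<And>x. (\<lambda>n. f n x) \<longlonglongrightarrow> h x"
    and bound: "\<And>n x. norm (f n x) \<le> g x"
    and g: "g summable_on UNIV"
    and S: "S \<longlonglongrightarrow> L"
  shows "(h has_sum L) UNIV"
proof -
  have h_bound: "norm (h x) \<le> g x" for x
    using tendsto_norm[OF lim] by (rule tendsto_upperbound) (use bound in auto)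
  then have "h summable_on UNIV"
    using Infinite_Sum.abs_summable_summable Infinite_Sum.abs_summable_on_comparison_test'[OF g] by blast
  then obtain L' where L': "(h has_sum L') UNIV"
    by (auto simp: summable_on_def)
  have sums: "(\<lambda>k. F (e k)) sums s" if "(F has_sum s) UNIV" for F :: "'a \<Rightarrow> 'b" and s
    using that has_sum_imp_sums has_sum_reindex_bij_betw[OF e] by blast
  have "(\<lambda>k. g (e k)) summable_on UNIV"
    using g summable_on_reindex_bij_betw[OF e] by blast
  then have "summable (\<lambda>k. g (e k))"
    by (rule summable_on_imp_summable)
  moreover have "\<forall>\<^sub>F (k, n) in at_top \<times>\<^sub>F sequentially. norm (f n (e k)) \<le> g (e k)"
    by (rule always_eventually) (use bound in auto)
  ultimately have "(\<lambda>n. \<Sum>k. f n (e k)) \<longlonglongrightarrow> (\<Sum>k. h (e k))"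
    using tannerys_theorem[of "\<lambda>k n. f n (e k)" "\<lambda>k. h (e k)" sequentially "\<lambda>k. g (e k)"] lim
    by simp
  moreover have "(\<Sum>k. f n (e k)) = S n" for n
    using sums[OF f] by (simp add: sums_iff)
  moreover have "(\<Sum>k. h (e k)) = L'"
    using sums[OF L'] by (simp add: sums_iff)
  ultimately have "S \<longlonglongrightarrow> L'" by simp
  then have "L' = L" using S by (rule LIMSEQ_unique)
  with L' show ?thesis by simp
qed

text \<open>Bailey's lemma relative to a = q, both free parameters sent to infinity, tested on the
  kernel at a single index r. Terms with k < r vanish; k = i + r turns the rest into
  \<open>q_vandermonde\<close> with M = N - r and c = 2 r + 1, as (i + r)(i + r + 1) = r (r + 1) + i
  (i + 2 r + 1).\<close>

lemma bailey_step_nonneg: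
  assumes "norm q < 1"
  shows "(\<Sum>k\<le>N. q ^ (k * k + k) * (qrec q (int N - int k) * qrec q (int k - int r) * qrec q (int k + int r + 1)))
           = q ^ (r * r + r) * (qrec q (int N - int r) * qrec q (int N + int r + 1))"
    (is "(\<Sum>k\<le>N. ?f k) = _")
proof (cases "r \<le> N")
  case False
  then show ?thesis by simp
next
  case True
  then obtain M where N: "N = M + r"
    by (metis le_add_diff_inverse2)
  have "(\<Sum>k\<le>N. ?f k) = (\<Sum>k\<in>{r..N}. ?f k)"
    by (rule sum.mono_neutral_right) auto
  also have "\<dots> = (\<Sum>i\<le>M. ?f (i + r))"
    using sum.shift_bounds_cl_nat_ivl[of ?f 0 r M] by (simp add: N atMost_atLeast0)
  also have "\<dots> = (\<Sum>i\<le>M. q ^ (r * r + r) * (q ^ (i * (i + (r + r + 1))) *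
      (qrec q (int (M - i)) * qrec q (int i) * qrec q (int (i + (r + r + 1))))))"
  proof (rule sum.cong[OF refl])
    fix i assume i: "i \<in> {..M}"
    have 1: "q ^ ((i + r) * (i + r) + (i + r)) = q ^ (r * r + r) * q ^ (i * (i + (r + r + 1)))"
      by (simp flip: power_add add: algebra_simps)
    have 2: "int N - int (i + r) = int (M - i)" "int (i + r) - int r = int i"
      "int (i + r) + int r + 1 = int (i + (r + r + 1))"
      using i by (auto simp: N)
    show "?f (i + r) = q ^ (r * r + r) * (q ^ (i * (i + (r + r + 1))) *
      (qrec q (int (M - i)) * qrec q (int i) * qrec q (int (i + (r + r + 1)))))"
      unfolding 1 2 by (simp add: mult.assoc)
  qed
  also have "\<dots> = q ^ (r * r + r) * (qrec q (int M) * qrec q (int (M + (r + r + 1))))"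
    by (simp only: sum_distrib_left[symmetric] q_vandermonde[OF assms])
  also have "int M = int N - int r" by (simp add: N)
  also have "int (M + (r + r + 1)) = int N + int r + 1" by (simp add: N)
  finally show ?thesis .
qed

lemma bailey_step:
  assumes "norm q < 1"
  shows "(\<Sum>k\<le>N. q ^ (k * k + k) * (qrec q (int N - int k) * qrec q (int k - r) * qrec q (int k + r + 1)))
           = q powi (r * r + r) * (qrec q (int N - r) * qrec q (int N + r + 1))"
proof (cases "r \<ge> 0")
  case True
  then obtain s where r: "r = int s" using nonneg_int_cases by blast
  have "r * r + r = int (s * s + s)" by (simp add: r)
  then have "q powi (r * r + r) = q ^ (s * s + s)" by (simp only: power_int_of_nat)
  then show ?thesis using bailey_step_nonneg[OF assms, of N s] by (simp add: r)
next
  case False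
  then have "- 1 - r \<ge> 0" by simp
  \<comment> \<open>The reflection s = -1 - r fixes \<open>r * r + r\<close> and merely swaps the
    two reciprocals on each side that contain r.\<close>
  then obtain s where "- 1 - r = int s" using nonneg_int_cases by blast
  then have r: "r = - 1 - int s" by simp
  have "r * r + r = int (s * s + s)" by (simp add: r algebra_simps)
  then have "q powi (r * r + r) = q ^ (s * s + s)" by (simp only: power_int_of_nat)
  moreover have "n - r = n + int s + 1" "n + r + 1 = n - int s" for n
    by (simp_all add: r)
  ultimately show ?thesis using bailey_step_nonneg[OF assms, of N s]
    by (simp only: mult_ac)
qed

lemma norm_power_pronic_le:
  fixes q :: complex
  assumes "norm q < 1"
  shows "norm (q ^ (k * k + k)) \<le> norm q ^ k"
  using assms by (simp add: norm_power power_decreasing)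

lemma summable_on_norm_power:
  fixes q :: complex
  assumes "norm q < 1"
  shows "(\<lambda>k. c * norm q ^ k) summable_on UNIV"
  using assms by (intro summable_on_cmult_right norm_summable_imp_summable_on)
     (simp add: norm_power summable_geometric)

text \<open>Let N tend to infinity in \<open>bailey_step\<close>: the left side acquires one factor
  1 / (q)_inf and the right side two, so one of them survives.\<close>

lemma bailey_limit:
  assumes q: "norm q < 1"
  shows "((\<lambda>k. q ^ (k * k + k) * (qrec q (int k - r) * qrec q (int k + r + 1)))
           has_sum (q powi (r * r + r) / qpoch_inf q q)) UNIV"
proof -
  obtain C where C: "C > 0" "\<And>n. norm (qrec q n) \<le> C"
    using qrec_bounded[OF q] by blast
  let ?P = "qpoch_inf q q"
  let ?f = "\<lambda>N k. q ^ (k * k + k) * (qrec q (int N - int k) * qrec q (int k - r) * qrec q (int k + r + 1))"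
  have "((\<lambda>k. q ^ (k * k + k) * (1 / ?P * qrec q (int k - r) * qrec q (int k + r + 1)))
           has_sum (q powi (r * r + r) * (1 / ?P * (1 / ?P)))) UNIV"
  proof (rule has_sum_dominated_convergence[where e = id and f = ?f])
    show "(?f N has_sum q powi (r * r + r) * (qrec q (int N - r) * qrec q (int N + r + 1))) UNIV" for N
    proof -
      have "(?f N has_sum (\<Sum>k\<le>N. ?f N k)) UNIV \<longleftrightarrow> (?f N has_sum (\<Sum>k\<le>N. ?f N k)) {..N}"
        by (rule has_sum_cong_neutral) auto
      then have "(?f N has_sum (\<Sum>k\<le>N. ?f N k)) UNIV"
        using has_sum_finite[of "{..N}" "?f N"] by blast
      then show ?thesis
        by (simp only: bailey_step[OF q])
    qed
    show "(\<lambda>N. ?f N k) \<longlonglongrightarrow> q ^ (k * k + k) * (1 / ?P * qrec q (int k - r) * qrec q (int k + r + 1))" for k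
      using qrec_tendsto[OF q, of "- int k"] by (intro tendsto_intros) simp
    show "norm (?f N k) \<le> (C * C * C) * norm q ^ k" for N k
    proof -
      have "norm (?f N k) \<le> norm q ^ k * (C * C * C)"
        unfolding norm_mult
        by (intro mult_mono C mult_nonneg_nonneg norm_power_pronic_le[OF q, unfolded norm_mult]) (use C(1) in auto)
      then show ?thesis by (simp add: mult_ac)
    qed
    show "(\<lambda>N. q powi (r * r + r) * (qrec q (int N - r) * qrec q (int N + r + 1)))
        \<longlonglongrightarrow> q powi (r * r + r) * (1 / ?P * (1 / ?P))"
      using qrec_tendsto[OF q, of "- r"] qrec_tendsto[OF q, of "r + 1"]
      by (intro tendsto_intros) (simp_all add: add.assoc)
  qed (use summable_on_norm_power[OF q] in auto)
  from has_sum_cmult_right[OF this, of ?P] show ?thesis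
    using qpoch_inf_nonzero[OF q] by (simp add: field_simps)
qed

lemma summable_on_times_nonneg:
  fixes f :: "'a \<Rightarrow> real" and g :: "'b \<Rightarrow> real"
  assumes "f summable_on A" "g summable_on B" "\<And>x. x \<in> A \<Longrightarrow> f x \<ge> 0" "\<And>y. y \<in> B \<Longrightarrow> g y \<ge> 0"
  shows "(\<lambda>(x, y). f x * g y) summable_on A \<times> B"
proof (rule summable_on_SigmaI)
  show "((\<lambda>y. case (x, y) of (x, y) \<Rightarrow> f x * g y) has_sum f x * infsum g B) B" for x
    using assms(2) by (auto intro: has_sum_cmult_right)
  show "(\<lambda>x. f x * infsum g B) summable_on A"
    using assms(1) by (rule summable_on_cmult_left)
qed (use assms in auto)

text \<open>Put N = m + k. The inner sum over k up to N is \<open>bailey_step\<close>, whose value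
  is again the kernel, now at N; the outer sum over N is then \<open>bailey_limit\<close>.\<close>

lemma bailey_twofold:
  assumes q: "norm q < 1"
  shows "((\<lambda>(m, k). q ^ (k * k + k) * q ^ ((m + k) * (m + k) + (m + k)) *
            (qrec q (int m) * (qrec q (int k - r) * qrec q (int k + r + 1))))
           has_sum (q powi (2 * (r * r + r)) / qpoch_inf q q)) UNIV"
proof -
  obtain C where C: "C > 0" "\<And>n. norm (qrec q n) \<le> C"
    using qrec_bounded[OF q] by blast
  let ?g = "\<lambda>k. qrec q (int k - r) * qrec q (int k + r + 1)"
  let ?F = "\<lambda>(N, k). q ^ (N * N + N) * (q ^ (k * k + k) * (qrec q (int N - int k) * qrec q (int k - r) * qrec q (int k + r + 1)))"
  have "?F summable_on (UNIV \<times> UNIV)"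
  proof (rule Infinite_Sum.abs_summable_summable, rule Infinite_Sum.abs_summable_on_comparison_test')
    show "(\<lambda>(N, k). norm q ^ N * ((C * C * C) * norm q ^ k)) summable_on (UNIV \<times> UNIV)"
      using summable_on_norm_power[OF q, of 1] summable_on_norm_power[OF q, of "C * C * C"] C(1)
      by (intro summable_on_times_nonneg) auto
    fix x :: "nat \<times> nat"
    obtain N k where x: "x = (N, k)" by fastforce
    have "norm (?F x) \<le> norm q ^ N * (norm q ^ k * (C * C * C))"
      unfolding norm_mult x prod.case
      by (intro mult_mono C mult_nonneg_nonneg norm_power_pronic_le[OF q, unfolded norm_mult]) (use C(1) in auto)
    then show "norm (?F x) \<le> (case x of (N, k) \<Rightarrow> norm q ^ N * ((C * C * C) * norm q ^ k))"
      by (simp add: x mult_ac)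
  qed
  then have summable: "?F summable_on (SIGMA N:UNIV. {..N})"
    by (rule summable_on_subset) auto
  have "(?F has_sum (q powi (r * r + r) * (q powi (r * r + r) / qpoch_inf q q))) (SIGMA N:UNIV. {..N})"
  proof (rule has_sum_SigmaI[OF _ _ summable])
    show "((\<lambda>k. ?F (N, k)) has_sum q ^ (N * N + N) * (q powi (r * r + r) * (qrec q (int N - r) * qrec q (int N + r + 1)))) {..N}" for N
      unfolding prod.case by (rule has_sum_cmult_right) (rule has_sum_finiteI, simp, rule bailey_step[OF q, symmetric])
    show "((\<lambda>N. q ^ (N * N + N) * (q powi (r * r + r) * (qrec q (int N - r) * qrec q (int N + r + 1))))
        has_sum (q powi (r * r + r) * (q powi (r * r + r) / qpoch_inf q q))) UNIV"
      using has_sum_cmult_right[OF bailey_limit[OF q, of r], of "q powi (r * r + r)"]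
      by (simp add: mult.left_commute)
  qed
  also have "q powi (r * r + r) * (q powi (r * r + r) / qpoch_inf q q) = q powi (2 * (r * r + r)) / qpoch_inf q q"
    by (simp add: power_int_mult power2_eq_square power_int_mult_distrib del: distrib_left_numeral)
  finally have "(?F has_sum (q powi (2 * (r * r + r)) / qpoch_inf q q)) (SIGMA N:UNIV. {..N})" .
  moreover have "((\<lambda>(m, k). q ^ (k * k + k) * q ^ ((m + k) * (m + k) + (m + k)) *
            (qrec q (int m) * (qrec q (int k - r) * qrec q (int k + r + 1))))
           has_sum (q powi (2 * (r * r + r)) / qpoch_inf q q)) UNIV \<longleftrightarrow>
      (?F has_sum (q powi (2 * (r * r + r)) / qpoch_inf q q)) (SIGMA N:UNIV. {..N})"
    by (rule has_sum_reindex_bij_witness[where j = "\<lambda>(m, k). (m + k, k)" and i = "\<lambda>(N, k). (N - k, k)"])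
       (auto simp: mult_ac)
  ultimately show ?thesis by blast
qed

section \<open>Jacobi's triple product\<close>

text \<open>Every quadratic exponent in j is written a * \<open>choose2 j\<close> + b * j, which
  avoids halves and matches the shape of Jacobi's series.\<close>

definition choose2 :: "int \<Rightarrow> int" where
  "choose2 j = j * (j - 1) div 2"

lemma two_choose2: "2 * choose2 j = j * j - j"
proof -
  have "even (j * (j - 1))" by simp
  then show ?thesis by (simp add: choose2_def algebra_simps)
qed

lemma choose2_0 [simp]: "choose2 0 = 0"
  by (simp add: choose2_def)

lemma choose2_plus_1: "choose2 (j + 1) = choose2 j + j"
  using two_choose2[of j] two_choose2[of "j + 1"] by (simp add: algebra_simps)

lemma choose2_minus_1: "choose2 (j - 1) = choose2 j - j + 1"
  using two_choose2[of j] two_choose2[of "j - 1"] by (simp add: algebra_simps)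

lemma choose2_minus: "choose2 (- j) = choose2 j + j"
  using two_choose2[of j] two_choose2[of "- j"] by (simp add: algebra_simps)

lemma choose2_reflect: "choose2 (- 1 - j) = choose2 j + 2 * j + 1"
  using two_choose2[of j] two_choose2[of "- 1 - j"] by (simp add: algebra_simps)

section \<open>Absolute convergence of theta series\<close>

lemma summable_on_int:
  fixes f :: "int \<Rightarrow> real"
  assumes "(\<lambda>n. f (int n)) summable_on UNIV" "(\<lambda>n. f (- 1 - int n)) summable_on UNIV"
  shows "f summable_on UNIV"
proof -
  have "f summable_on range int" "f summable_on range (\<lambda>n. - 1 - int n)"
    using assms by (subst summable_on_reindex; simp add: inj_on_def o_def)+
  then have "f summable_on range int \<union> range (\<lambda>n. - 1 - int n)"
    by (rule summable_on_Un_disjoint) auto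
  moreover have "range int \<union> range (\<lambda>n. - 1 - int n) = UNIV"
  proof (intro equalityI subsetI UNIV_I)
    fix j :: int
    have "j = int (nat j) \<or> j = - 1 - int (nat (- 1 - j))" by linarith
    then show "j \<in> range int \<union> range (\<lambda>n. - 1 - int n)" by blast
  qed
  ultimately show ?thesis by simp
qed

text \<open>Consecutive terms have ratio w * r^n, which tends to 0 however large w is.\<close>

lemma theta_summable_nat:
  fixes w r :: real
  assumes "w > 0" "0 < r" "r < 1"
  shows "(\<lambda>n. w ^ n * r powi choose2 (int n)) summable_on UNIV"
proof (rule norm_summable_imp_summable_on)
  have "(\<lambda>n. w * r ^ n) \<longlonglongrightarrow> w * 0"
    using assms by (intro tendsto_intros LIMSEQ_power_zero) auto
  then have "\<forall>\<^sub>F n in sequentially. w * r ^ n < 1 / 2"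
    by (rule order_tendstoD) simp
  then obtain M where M: "\<And>n. n \<ge> M \<Longrightarrow> w * r ^ n < 1 / 2"
    by (auto simp: eventually_at_top_linorder)
  show "summable (\<lambda>n. norm (w ^ n * r powi choose2 (int n)))"
  proof (rule summable_ratio_test[of "1 / 2" M])
    fix n assume "n \<ge> M"
    have "w ^ Suc n * r powi choose2 (int (Suc n)) = (w * r ^ n) * (w ^ n * r powi choose2 (int n))"
      using choose2_plus_1[of "int n"] assms by (simp add: power_int_add add.commute)
    moreover have "(w * r ^ n) * (w ^ n * r powi choose2 (int n)) \<le> 1 / 2 * (w ^ n * r powi choose2 (int n))"
      using M[OF \<open>n \<ge> M\<close>] assms by (intro mult_right_mono) (auto intro!: mult_nonneg_nonneg simp: power_int_def)
    ultimately show "norm (norm (w ^ Suc n * r powi choose2 (int (Suc n)))) \<le> 1 / 2 * norm (norm (w ^ n * r powi choose2 (int n)))"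
      using assms by (simp add: abs_mult power_int_abs)
  qed simp
qed

lemma theta_summable:
  fixes w r :: real
  assumes "w > 0" "0 < r" "r < 1"
  shows "(\<lambda>j. w powi j * r powi choose2 j) summable_on UNIV"
proof (rule summable_on_int)
  show "(\<lambda>n. w powi int n * r powi choose2 (int n)) summable_on UNIV"
    using theta_summable_nat[OF assms] by simp
  \<comment> \<open>The reflection j = -1 - n turns the negative half into a series of the same
    kind, with r^2 / w in place of w.\<close>
  have "w powi (- 1 - int n) * r powi choose2 (- 1 - int n) = r / w * ((r\<^sup>2 / w) ^ n * r powi choose2 (int n))" for n
    using assms unfolding choose2_reflect
    by (simp add: power_int_diff power_int_add power_int_mult power_divide power_int_minus field_simps power2_eq_square power_mult_distrib)
  moreover have "(\<lambda>n. r / w * ((r\<^sup>2 / w) ^ n * r powi choose2 (int n))) summable_on UNIV"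
    using assms by (intro summable_on_cmult_right theta_summable_nat) auto
  ultimately show "(\<lambda>n. w powi (- 1 - int n) * r powi choose2 (- 1 - int n)) summable_on UNIV"
    by (simp only:)
qed

text \<open>Here \<open>g N j\<close> is the term of the finite triple product, namely a signed
  power times [2 N, N + j] / (q)_2N. The right side collects the contributions to z^j when the sum
  at N is multiplied by (1 - z q^N)(1 - q^(N+1) / z).\<close>

lemma jacobi_recurrence:
  fixes q z :: complex
  assumes q: "norm q < 1" "q \<noteq> 0" and z: "z \<noteq> 0"
  defines "g \<equiv> \<lambda>N j. (-1) powi j * z powi j * q powi choose2 j * (qrec q (int N + j) * qrec q (int N - j))"
  shows "(1 - q * q ^ (2 * N)) * (1 - q * q ^ (2 * N + 1)) * g (Suc N) j =
      (1 + q * q ^ (2 * N)) * g N j - z * q ^ N * g N (j - 1) - q / z * q ^ N * g N (j + 1)"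
proof -
  \<comment> \<open>\<open>A\<close> and \<open>B\<close> have the largest arguments that occur, so
    every other reciprocal is a polynomial or rational multiple of them by
    \<open>qrec_diff_1\<close>; a rational identity in p, q, u and z remains.\<close>
  define p u E A B where "p = q ^ N" and "u = q powi j" and "E = (-1) powi j * z powi j * q powi choose2 j"
    and "A = qrec q (int (Suc N) + j)" and "B = qrec q (int (Suc N) - j)"
  have u0: "u \<noteq> 0" using q by (simp add: u_def)
  have E1: "(-1) powi (j - 1) * z powi (j - 1) * q powi choose2 (j - 1) = - (E * q / (z * u))"
    using q z by (simp add: choose2_minus_1 E_def u_def power_int_diff power_int_add)
  have E2: "(-1) powi (j + 1) * z powi (j + 1) * q powi choose2 (j + 1) = - (E * z * u)"
    using q z by (simp add: choose2_plus_1 E_def u_def power_int_add)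
  have pow: "q powi (int n + i) = q ^ n * q powi i" "q powi (int n - i) = q ^ n / q powi i" for n i
    using q by (simp_all add: power_int_add power_int_diff)
  have A1: "qrec q (int N + j) = (1 - p * q * u) * A"
    using qrec_diff_1[OF q(1), of "int (Suc N) + j"] unfolding pow by (simp add: A_def p_def u_def mult_ac)
  have A2: "qrec q (int N + (j - 1)) = (1 - p * u) * ((1 - p * q * u) * A)"
    using qrec_diff_1[OF q(1), of "int N + j"] unfolding pow A1 by (simp add: p_def u_def mult_ac add_ac add_diff_eq)
  have A3: "qrec q (int N + (j + 1)) = A" by (simp add: A_def add_ac)
  have B1: "qrec q (int N - j) = (1 - p * q / u) * B"
    using qrec_diff_1[OF q(1), of "int (Suc N) - j"] unfolding pow by (simp add: B_def p_def u_def mult_ac)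
  have B2: "qrec q (int N - (j + 1)) = (1 - p / u) * ((1 - p * q / u) * B)"
    using qrec_diff_1[OF q(1), of "int N - j"] unfolding pow B1 by (simp add: p_def u_def mult_ac algebra_simps)
  have B3: "qrec q (int N - (j - 1)) = B" by (simp add: B_def algebra_simps)
  have P: "q ^ (2 * N) = p * p" "q ^ (2 * N + 1) = p * p * q"
    by (simp_all add: p_def mult_2 power_add)
  show ?thesis
    unfolding g_def A1 A2 A3 B1 B2 B3 E1 E2 P E_def[symmetric] A_def[symmetric] B_def[symmetric] p_def[symmetric]
    using u0 z by (simp add: field_simps)
qed

lemma has_sum_int_shift:
  fixes f :: "int \<Rightarrow> 'a::{comm_monoid_add, topological_space}"
  shows "((\<lambda>j. f (j + c)) has_sum S) UNIV \<longleftrightarrow> (f has_sum S) UNIV"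
  by (rule has_sum_reindex_bij_witness[where j = "\<lambda>j. j + c" and i = "\<lambda>j. j - c"]) auto

lemma has_sum_int_reflect:
  fixes f :: "int \<Rightarrow> 'a::{comm_monoid_add, topological_space}"
  shows "((\<lambda>j. f (c - j)) has_sum S) UNIV \<longleftrightarrow> (f has_sum S) UNIV"
  by (rule has_sum_reindex_bij_witness[where j = "\<lambda>j. c - j" and i = "\<lambda>j. c - j"]) auto

lemma has_sum_single:
  fixes f :: "'a \<Rightarrow> 'b::{comm_monoid_add, topological_space}"
  assumes "\<And>x. x \<noteq> a \<Longrightarrow> f x = 0" "s = f a"
  shows "(f has_sum s) UNIV"
proof -
  have "(f has_sum s) UNIV \<longleftrightarrow> (f has_sum s) {a}"
    by (rule has_sum_cong_neutral) (use assms in auto)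
  then show ?thesis using assms by (auto intro: has_sum_finiteI)
qed

text \<open>Sum \<open>jacobi_recurrence\<close> over all integers: shifting j leaves the total
  unchanged, so the three coefficients simply add up, and their sum factors into the next factors of
  the two products (\<open>factor\<close>).\<close>

lemma jacobi_finite:
  fixes q z :: complex
  assumes q: "norm q < 1" "q \<noteq> 0" and z: "z \<noteq> 0"
  shows "((\<lambda>j. (-1) powi j * z powi j * q powi choose2 j * (qrec q (int N + j) * qrec q (int N - j)))
           has_sum (qpoch z q N * qpoch (q / z) q N / qpoch q q (2 * N))) UNIV"
    (is "(?g N has_sum ?S N) _")
proof (induction N)
  case 0
  show ?case
  proof (rule has_sum_single[of 0])
    fix j :: int assume "j \<noteq> 0"
    then show "?g 0 j = 0" by (cases "j < 0") auto
  qed simp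
next
  case (Suc N)
  let ?d = "(1 - q * q ^ (2 * N)) * (1 - q * q ^ (2 * N + 1))"
  have d: "?d \<noteq> 0"
    using one_minus_power_nonzero[OF q(1), of "2 * N"] one_minus_power_nonzero[OF q(1), of "2 * N + 1"] by simp
  have factor: "1 + q * q ^ (2 * N) - z * q ^ N - q / z * q ^ N = (1 - z * q ^ N) * (1 - q / z * q ^ N)"
    using z by (simp add: field_simps mult_2_right power_add)
  have collect: "a * s + (- b) * s + (- c) * s = (a - b - c) * s" for a b c s :: complex
    by (simp add: algebra_simps)
  have up: "((\<lambda>j. ?g N (j + 1)) has_sum ?S N) UNIV"
    using Suc.IH by (subst has_sum_int_shift)
  have down: "((\<lambda>j. ?g N (j - 1)) has_sum ?S N) UNIV"
    using has_sum_int_shift[of "?g N" "- 1" "?S N"] Suc.IH by simp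
  have "((\<lambda>j. (1 + q * q ^ (2 * N)) * ?g N j + (- (z * q ^ N)) * ?g N (j - 1) + (- (q / z * q ^ N)) * ?g N (j + 1))
      has_sum ((1 + q * q ^ (2 * N)) * ?S N + (- (z * q ^ N)) * ?S N + (- (q / z * q ^ N)) * ?S N)) UNIV"
    by (intro has_sum_add has_sum_cmult_right Suc.IH up down)
  also have "(\<lambda>j. (1 + q * q ^ (2 * N)) * ?g N j + (- (z * q ^ N)) * ?g N (j - 1) + (- (q / z * q ^ N)) * ?g N (j + 1))
      = (\<lambda>j. ?d * ?g (Suc N) j)"
    by (rule ext) (simp only: jacobi_recurrence[OF assms], simp)
  finally have "((\<lambda>j. ?d * ?g (Suc N) j) has_sum ((1 + q * q ^ (2 * N)) * ?S N + (- (z * q ^ N)) * ?S N + (- (q / z * q ^ N)) * ?S N)) UNIV" .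
  from has_sum_cmult_right[OF this, of "1 / ?d"]
  have "(?g (Suc N) has_sum (1 / ?d * ((1 + q * q ^ (2 * N)) * ?S N + (- (z * q ^ N)) * ?S N + (- (q / z * q ^ N)) * ?S N))) UNIV"
    using d by (simp add: mult.assoc[symmetric])
  also have "1 / ?d * ((1 + q * q ^ (2 * N)) * ?S N + (- (z * q ^ N)) * ?S N + (- (q / z * q ^ N)) * ?S N) =
      1 / ?d * ((1 - z * q ^ N) * (1 - q / z * q ^ N) * ?S N)"
    by (simp only: collect factor)
  also have "\<dots> = ?S (Suc N)"
    using d qpoch_nonzero[OF q(1), of "2 * N"] by (simp add: qpoch_Suc mult_ac)
  finally show ?case .
qed

text \<open>The limit of \<open>jacobi_finite\<close>, dominated by the theta series in the norms of
  z and q. The two reciprocals contribute 1 / (q)_inf^2 on the left, the denominator (q)_2N only 1 /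
  (q)_inf on the right.\<close>

theorem jacobi_triple_product:
  fixes q z :: complex
  assumes q: "norm q < 1" "q \<noteq> 0" and z: "z \<noteq> 0"
  shows "((\<lambda>j. (-1) powi j * z powi j * q powi choose2 j)
           has_sum (qpoch_inf q q * qpoch_inf z q * qpoch_inf (q / z) q)) UNIV"
proof -
  obtain C where C: "C > 0" "\<And>n. norm (qrec q n) \<le> C"
    using qrec_bounded[OF q(1)] by blast
  let ?P = "qpoch_inf q q"
  have P: "?P \<noteq> 0" by (rule qpoch_inf_nonzero[OF q(1)])
  have "((\<lambda>j. (-1) powi j * z powi j * q powi choose2 j * (1 / ?P * (1 / ?P)))
     has_sum (qpoch_inf z q * qpoch_inf (q / z) q / ?P)) UNIV"
  proof (rule has_sum_dominated_convergence[OF bij_int_decode jacobi_finite[OF assms]])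
    show "(\<lambda>N. (-1) powi j * z powi j * q powi choose2 j * (qrec q (int N + j) * qrec q (int N - j)))
        \<longlonglongrightarrow> (-1) powi j * z powi j * q powi choose2 j * (1 / ?P * (1 / ?P))" for j
      using qrec_tendsto[OF q(1), of j] qrec_tendsto[OF q(1), of "- j"] by (intro tendsto_intros) simp_all
    show "norm ((-1) powi j * z powi j * q powi choose2 j * (qrec q (int N + j) * qrec q (int N - j)))
        \<le> norm z powi j * norm q powi choose2 j * (C * C)" for N j
      unfolding norm_mult norm_power_int
      by (intro mult_mono C mult_nonneg_nonneg) (use C(1) in auto)
    show "(\<lambda>j. norm z powi j * norm q powi choose2 j * (C * C)) summable_on UNIV"
      using q z by (intro summable_on_cmult_left theta_summable) auto
    have "filterlim (\<lambda>N::nat. 2 * N) at_top at_top"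
      by (intro filterlim_subseq) (simp add: strict_mono_def)
    from filterlim_compose[OF qpoch_tendsto[OF q(1)] this]
    show "(\<lambda>N. qpoch z q N * qpoch (q / z) q N / qpoch q q (2 * N)) \<longlonglongrightarrow> qpoch_inf z q * qpoch_inf (q / z) q / ?P"
      by (intro tendsto_intros qpoch_tendsto q P)
  qed
  from has_sum_cmult_right[OF this, of "?P * ?P"] show ?thesis
    using P by (simp add: field_simps)
qed

section \<open>Bressoud's finite Rogers--Ramanujan identities\<close>

text \<open>Meant for the remainder in \<open>bressoud_even_Suc\<close>. Finite support supplies a
  sum, which the reflection then identifies with its own negative.\<close>

lemma has_sum_0_if_odd:
  fixes f :: "int \<Rightarrow> complex"
  assumes "finite {j. f j \<noteq> 0}" "\<And>j. f (c - j) = - f j"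
  shows "(f has_sum 0) UNIV"
proof -
  have "f summable_on {j. f j \<noteq> 0}"
    using assms(1) by (rule summable_on_finite)
  then have "f summable_on UNIV"
    by (rule summable_on_cong_neutral[THEN iffD1, rotated -1]) auto
  then obtain S where S: "(f has_sum S) UNIV" by (auto simp: summable_on_def)
  then have "((\<lambda>j. f (c - j)) has_sum S) UNIV"
    by (subst has_sum_int_reflect)
  then have "((\<lambda>j. - f j) has_sum S) UNIV"
    by (simp only: assms(2))
  moreover have "((\<lambda>j. - f j) has_sum - S) UNIV"
    using S by (subst has_sum_uminus) simp
  ultimately have "S = - S" by (rule has_sum_unique)
  with S show ?thesis by simp
qed

lemma power_int_minus_one_reflect: "(-1 :: complex) powi (- 1 - j) = - ((-1) powi j)"
  using power_int_minus_one_diff_commute[of "- 1" j] power_int_add_1[of "-1::complex" j] by (simp add: power_int_add)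

text \<open>
  The even and odd terms are those of \<open>[2 N, N - 2 j] / (q)\<^sub>2\<^sub>N\<close> and \<open>[2 N + 1, N - 2 j] / (q)\<^sub>2\<^sub>N\<^sub>+\<^sub>1\<close>
  with exponents \<open>j (5 j + 1) / 2\<close> and \<open>j (5 j + 3) / 2\<close>. Both sides of Bressoud's identities satisfy the
  same coupled first-order recurrence in N.
\<close>

definition bressoud_even :: "complex \<Rightarrow> nat \<Rightarrow> int \<Rightarrow> complex" where
  "bressoud_even q N j = (-1) powi j * q powi (5 * choose2 j + 3 * j) * (qrec q (int N + 2 * j) * qrec q (int N - 2 * j))"

definition bressoud_odd :: "complex \<Rightarrow> nat \<Rightarrow> int \<Rightarrow> complex" where
  "bressoud_odd q N j = (-1) powi j * q powi (5 * choose2 j + 4 * j) * (qrec q (int N - 2 * j) * qrec q (int N + 2 * j + 1))"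

text \<open>The recurrence fails term by term by the remainder \<open>c\<close>, which is
  antisymmetric under j -> -1 - j: the reciprocals trade places, the powers of q balance and the
  sign flips. The odd term is taken at -j so that its reciprocals have the arguments N + 2 j and N +
  1 - 2 j.\<close>

lemma bressoud_even_Suc:
  fixes q :: complex and N :: nat
  assumes q: "norm q < 1" "q \<noteq> 0"
  defines "c \<equiv> \<lambda>j. (-1) powi j * q powi (5 * choose2 j + 3 * j) *
     (q powi (int N + 1 + 2 * j) * (qrec q (int N + 1 + 2 * j) * qrec q (int N - 1 - 2 * j)))"
  shows "(1 - q * q ^ (2 * N)) * (1 - q * q ^ (2 * N + 1)) * bressoud_even q (Suc N) j
      = (1 - q * q ^ (2 * N)) * q ^ Suc N * bressoud_odd q N (- j) + bressoud_even q N j + c j"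
    and "c (- 1 - j) = - c j"
    and "finite {j. c j \<noteq> 0}"
proof -
  define p u E A B where "p = q ^ N" and "u = q powi (2 * j)" and "E = (-1) powi j * q powi (5 * choose2 j + 3 * j)"
    and "A = qrec q (int N + 1 + 2 * j)" and "B = qrec q (int N + 1 - 2 * j)"
  have u0: "u \<noteq> 0" using q by (simp add: u_def)
  have e: "5 * choose2 (- j) + 4 * (- j) = (5 * choose2 j + 3 * j) - 2 * j"
    by (simp add: choose2_minus)
  have "q powi (5 * choose2 (- j) + 4 * (- j)) = q powi (5 * choose2 j + 3 * j) / u"
    unfolding e u_def by (rule power_int_diff) (use q in simp)
  then have E: "(-1) powi (- j) * q powi (5 * choose2 (- j) + 4 * (- j)) = E / u"
    unfolding power_int_minus_one_minus E_def by (simp only: times_divide_eq_right)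
  have pow: "q powi (int n + i) = q ^ n * q powi i" "q powi (int n - i) = q ^ n / q powi i" for n i
    using q by (simp_all add: power_int_add power_int_diff)
  have x: "q powi (int N + 1 + 2 * j) = p * q * u"
    using pow(1)[of "Suc N" "2 * j"] by (simp add: p_def u_def mult_ac add_ac)
  have y: "q powi (int N + 1 - 2 * j) = p * q / u"
    using pow(2)[of "Suc N" "2 * j"] by (simp add: p_def u_def mult_ac add_ac)
  have w: "q powi (int N - 2 * j) = p / u"
    using pow(2)[of "N" "2 * j"] by (simp add: p_def u_def)
  have A1: "qrec q (int N + 2 * j) = (1 - p * q * u) * A"
    using qrec_diff_1[OF q(1), of "int N + 1 + 2 * j"] unfolding x by (simp add: A_def algebra_simps)
  have B1: "qrec q (int N - 2 * j) = (1 - p * q / u) * B"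
    using qrec_diff_1[OF q(1), of "int N + 1 - 2 * j"] unfolding y by (simp add: B_def algebra_simps)
  have B2: "qrec q (int N - 1 - 2 * j) = (1 - p / u) * ((1 - p * q / u) * B)"
    using qrec_diff_1[OF q(1), of "int N - 2 * j"] unfolding w B1 by (simp add: algebra_simps)
  have P: "q ^ (2 * N) = p * p" "q ^ (2 * N + 1) = p * p * q" "q ^ Suc N = p * q"
    by (simp_all add: p_def mult_2 power_add)
  have S: "int (Suc N) + 2 * j = int N + 1 + 2 * j" "int (Suc N) - 2 * j = int N + 1 - 2 * j"
      "int N - 2 * (- j) = int N + 2 * j" "int N + 2 * (- j) + 1 = int N + 1 - 2 * j"
    by simp_all
  show "(1 - q * q ^ (2 * N)) * (1 - q * q ^ (2 * N + 1)) * bressoud_even q (Suc N) j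
      = (1 - q * q ^ (2 * N)) * q ^ Suc N * bressoud_odd q N (- j) + bressoud_even q N j + c j"
    unfolding bressoud_even_def bressoud_odd_def c_def S A1 B1 B2 P x E A_def[symmetric] B_def[symmetric] E_def[symmetric]
    using u0 by (simp add: field_simps)
  have r: "q powi (5 * choose2 (- 1 - j) + 3 * (- 1 - j)) * q powi (int N + 1 + 2 * (- 1 - j))
      = q powi (5 * choose2 j + 3 * j) * q powi (int N + 1 + 2 * j)"
    using q(2) by (simp add: choose2_reflect algebra_simps flip: power_int_add)
  have s: "int N + 1 + 2 * (- 1 - j) = int N - 1 - 2 * j" "int N - 1 - 2 * (- 1 - j) = int N + 1 + 2 * j"
    by simp_all
  have "c (- 1 - j) = (-1) powi (- 1 - j) * (q powi (5 * choose2 (- 1 - j) + 3 * (- 1 - j)) * q powi (int N + 1 + 2 * (- 1 - j)))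
      * (qrec q (int N + 1 + 2 * (- 1 - j)) * qrec q (int N - 1 - 2 * (- 1 - j)))"
    by (simp only: c_def mult.assoc)
  also have "\<dots> = - c j"
    unfolding r power_int_minus_one_reflect unfolding s c_def by (simp add: mult_ac)
  finally show "c (- 1 - j) = - c j" .
  have "i \<in> {- (int N + 1)..int N + 1}" if "c i \<noteq> 0" for i
  proof -
    have "\<not> int N + 1 + 2 * i < 0" "\<not> int N - 1 - 2 * i < 0"
      using that by (auto simp: c_def)
    then show ?thesis unfolding atLeastAtMost_iff by linarith
  qed
  then have "{j. c j \<noteq> 0} \<subseteq> {- (int N + 1)..int N + 1}" by blast
  then show "finite {j. c j \<noteq> 0}" by (rule finite_subset) simp
qed

text \<open>Here the remainder is itself an odd term, at -1 - j. Summed over j it has the same total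
  as the term at j, so together the two contribute the factor 1 - q^(N+1).\<close>

lemma bressoud_odd_Suc:
  assumes q: "norm q < 1" "q \<noteq> 0"
  shows "(1 - q * q ^ (2 * N + 1)) * (1 - q * q ^ (2 * N + 2)) * bressoud_odd q (Suc N) j
      = (1 - q * q ^ (2 * N + 1)) * q ^ Suc N * bressoud_even q (Suc N) (- j)
        + bressoud_odd q N j - q ^ Suc N * bressoud_odd q N (- 1 - j)"
proof -
  define p u E A B where "p = q ^ N" and "u = q powi (2 * j)" and "E = (-1) powi j * q powi (5 * choose2 j + 4 * j)"
    and "A = qrec q (int N + 2 + 2 * j)" and "B = qrec q (int N + 1 - 2 * j)"
  have u0: "u \<noteq> 0" using q by (simp add: u_def)
  have e: "5 * choose2 (- j) + 3 * (- j) = (5 * choose2 j + 4 * j) - 2 * j"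
    by (simp add: choose2_minus)
  have "q powi (5 * choose2 (- j) + 3 * (- j)) = q powi (5 * choose2 j + 4 * j) / u"
    unfolding e u_def by (rule power_int_diff) (use q in simp)
  then have E1: "(-1) powi (- j) * q powi (5 * choose2 (- j) + 3 * (- j)) = E / u"
    unfolding power_int_minus_one_minus E_def by (simp only: times_divide_eq_right)
  have e2: "5 * choose2 (- 1 - j) + 4 * (- 1 - j) = (5 * choose2 j + 4 * j) + (2 * j + 1)"
    by (simp add: choose2_reflect)
  have "q powi (5 * choose2 (- 1 - j) + 4 * (- 1 - j)) = q powi (5 * choose2 j + 4 * j) * (u * q)"
    unfolding e2 u_def by (simp only: power_int_add_1 power_int_add power_int_1_right q(2) simp_thms)
  then have E2: "(-1) powi (- 1 - j) * q powi (5 * choose2 (- 1 - j) + 4 * (- 1 - j)) = - (E * u * q)"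
    unfolding power_int_minus_one_reflect E_def by (simp only: mult.assoc mult_minus_left)
  have pow: "q powi (int n + i) = q ^ n * q powi i" "q powi (int n - i) = q ^ n / q powi i" for n i
    using q by (simp_all add: power_int_add power_int_diff)
  have x: "q powi (int N + 2 + 2 * j) = p * q * q * u"
    using pow(1)[of "Suc (Suc N)" "2 * j"] by (simp add: p_def u_def mult_ac add_ac)
  have y: "q powi (int N + 1 - 2 * j) = p * q / u"
    using pow(2)[of "Suc N" "2 * j"] by (simp add: p_def u_def mult_ac add_ac)
  have w: "q powi (int N - 2 * j) = p / u"
    using pow(2)[of "N" "2 * j"] by (simp add: p_def u_def)
  have A1: "qrec q (int N + 2 * j + 1) = (1 - p * q * q * u) * A"
    using qrec_diff_1[OF q(1), of "int N + 2 + 2 * j"] unfolding x by (simp add: A_def algebra_simps)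
  have B1: "qrec q (int N - 2 * j) = (1 - p * q / u) * B"
    using qrec_diff_1[OF q(1), of "int N + 1 - 2 * j"] unfolding y by (simp add: B_def algebra_simps)
  have B2: "qrec q (int N - 2 * j - 1) = (1 - p / u) * ((1 - p * q / u) * B)"
    using qrec_diff_1[OF q(1), of "int N - 2 * j"] unfolding w B1 by (simp add: algebra_simps)
  have P: "q ^ (2 * N + 1) = p * p * q" "q ^ (2 * N + 2) = p * p * q * q" "q ^ Suc N = p * q"
    by (simp_all add: p_def mult_2 power_add)
  have S: "int (Suc N) - 2 * j = int N + 1 - 2 * j" "int (Suc N) + 2 * j + 1 = int N + 2 + 2 * j"
      "int (Suc N) + 2 * (- j) = int N + 1 - 2 * j" "int (Suc N) - 2 * (- j) = int N + 2 * j + 1"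
      "int N - 2 * (- 1 - j) = int N + 2 + 2 * j" "int N + 2 * (- 1 - j) + 1 = int N - 2 * j - 1"
    by simp_all
  show ?thesis
    unfolding bressoud_even_def bressoud_odd_def S A1 B1 B2 P E1 E2 A_def[symmetric] B_def[symmetric] E_def[symmetric]
    using u0 by (simp add: field_simps)
qed

text \<open>A Rogers-Ramanujan polynomial divided by (q)_N; only a = 0 and a = 1 occur.\<close>

definition rr_sum :: "nat \<Rightarrow> complex \<Rightarrow> nat \<Rightarrow> complex" where
  "rr_sum a q N = (\<Sum>n\<le>N. q ^ (n * n + a * n) * (qrec q (int n) * qrec q (int N - int n)))"

text \<open>Both parts split a factor under the sum: 1 - q^(N+1) = (1 - q^(N+1-n)) + q^(N+1-n) (1 -
  q^n) for the first, 1 = q^(N+1-n) + (1 - q^(N+1-n)) for the second. The factor 1 - q^(N+1-n)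
  lowers N + 1 to N, and 1 - q^n lowers n.\<close>

lemma rr_sum_Suc:
  assumes q: "norm q < 1"
  shows "(1 - q * q ^ N) * rr_sum 0 q (Suc N) = rr_sum 0 q N + q ^ Suc N * rr_sum 1 q N"
    and "rr_sum 1 q (Suc N) = q ^ Suc N * rr_sum 0 q (Suc N) + rr_sum 1 q N"
proof -
  have R: "qrec q (int N - int n) = (1 - q ^ (Suc N - n)) * qrec q (int (Suc N) - int n)" if "n \<le> Suc N" for n
  proof -
    have 1: "int (Suc N - n) = int (Suc N) - int n" and 2: "int (Suc N - n) - 1 = int N - int n"
      using that by (simp_all add: of_nat_diff)
    show ?thesis
      using qrec_diff_1[OF q, of "int (Suc N - n)"] unfolding power_int_of_nat 2 unfolding 1 .
  qed
  have pow: "q ^ n * q ^ (Suc N - n) = q * q ^ N" if "n \<le> Suc N" for n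
    using that by (simp flip: power_add power_Suc)
  \<comment> \<open>The added term n = N + 1 contains \<open>qrec q (- 1)\<close>, which is 0; this
    aligns the ranges for N and N + 1.\<close>
  have ext: "rr_sum a q N = (\<Sum>n\<le>Suc N. q ^ (n * n + a * n) * (qrec q (int n) * qrec q (int N - int n)))" for a
    by (simp add: rr_sum_def)
  note R' = qrec_of_nat_pred[OF q, folded power_Suc]
  let ?h = "\<lambda>n. q ^ (n * n) * q ^ (Suc N - n) * ((1 - q ^ n) * qrec q (int n) * qrec q (int (Suc N) - int n))"
  have "(1 - q * q ^ N) * rr_sum 0 q (Suc N) = (\<Sum>n\<le>Suc N. q ^ (n * n + 0 * n) * (qrec q (int n) * qrec q (int N - int n)) + ?h n)"
    unfolding rr_sum_def sum_distrib_left
  proof (rule sum.cong[OF refl])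
    fix n assume "n \<in> {..Suc N}"
    then have n: "n \<le> Suc N" by simp
    show "(1 - q * q ^ N) * (q ^ (n * n + 0 * n) * (qrec q (int n) * qrec q (int (Suc N) - int n))) =
         q ^ (n * n + 0 * n) * (qrec q (int n) * qrec q (int N - int n)) + ?h n"
      unfolding R[OF n] pow[OF n, symmetric] by (simp add: algebra_simps del: of_nat_Suc)
  qed
  also have "\<dots> = rr_sum 0 q N + (\<Sum>n\<le>Suc N. ?h n)"
    unfolding ext by (rule sum.distrib)
  also have "(\<Sum>n\<le>Suc N. ?h n) = (\<Sum>n\<le>N. ?h (Suc n))"
    by (subst sum.atMost_Suc_shift) simp
  also have "\<dots> = q ^ Suc N * rr_sum 1 q N"
    unfolding rr_sum_def sum_distrib_left
  proof (rule sum.cong[OF refl])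
    fix n assume "n \<in> {..N}"
    then have "Suc n * Suc n + (Suc N - Suc n) = Suc N + (n * n + 1 * n)" by simp
    then have *: "q ^ (Suc n * Suc n) * q ^ (Suc N - Suc n) = q ^ Suc N * q ^ (n * n + 1 * n)"
      by (simp only: flip: power_add)
    show "?h (Suc n) = q ^ Suc N * (q ^ (n * n + 1 * n) * (qrec q (int n) * qrec q (int N - int n)))"
      unfolding * R'[of n, symmetric] by (simp only: mult.assoc) simp
  qed
  finally show "(1 - q * q ^ N) * rr_sum 0 q (Suc N) = rr_sum 0 q N + q ^ Suc N * rr_sum 1 q N" .
  show "rr_sum 1 q (Suc N) = q ^ Suc N * rr_sum 0 q (Suc N) + rr_sum 1 q N"
    unfolding ext unfolding rr_sum_def sum_distrib_left sum.distrib[symmetric]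
  proof (rule sum.cong[OF refl])
    fix n assume "n \<in> {..Suc N}"
    then have n: "n \<le> Suc N" by simp
    show "q ^ (n * n + 1 * n) * (qrec q (int n) * qrec q (int (Suc N) - int n)) =
         q ^ Suc N * (q ^ (n * n + 0 * n) * (qrec q (int n) * qrec q (int (Suc N) - int n))) +
         q ^ (n * n + 1 * n) * (qrec q (int n) * qrec q (int N - int n))"
      unfolding R[OF n] power_Suc pow[OF n, symmetric] by (simp add: algebra_simps power_add del: of_nat_Suc)
  qed
qed

text \<open>The quotients of q-factorials reconcile the normalisations: \<open>rr_sum\<close> is
  divided by (q)_N, the bilateral terms by (q)_2N or (q)_2N+1. The induction is joint, and the odd
  identity at N + 1 uses the even one at N + 1.\<close>

theorem bressoud:
  assumes q: "norm q < 1" "q \<noteq> 0"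
  shows "(bressoud_even q N has_sum (qpoch q q N / qpoch q q (2 * N) * rr_sum 0 q N)) UNIV"
    and "(bressoud_odd q N has_sum (qpoch q q N / qpoch q q (2 * N + 1) * rr_sum 1 q N)) UNIV"
proof (induction N)
  case 0
  show "(bressoud_even q 0 has_sum (qpoch q q 0 / qpoch q q (2 * 0) * rr_sum 0 q 0)) UNIV"
  proof (rule has_sum_single[of 0])
    fix j :: int assume "j \<noteq> 0"
    then show "bressoud_even q 0 j = 0" by (cases "j < 0") (auto simp: bressoud_even_def)
  qed (simp add: bressoud_even_def rr_sum_def)
  show "(bressoud_odd q 0 has_sum (qpoch q q 0 / qpoch q q (2 * 0 + 1) * rr_sum 1 q 0)) UNIV"
  proof (rule has_sum_single[of 0])
    fix j :: int assume "j \<noteq> 0"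
    then show "bressoud_odd q 0 j = 0" by (cases "j < 0") (auto simp: bressoud_odd_def)
  qed (use qrec_of_nat[of q 1] in \<open>simp add: bressoud_odd_def rr_sum_def\<close>)
next
  case (Suc N)
  let ?P = "qpoch q q"
  note nz = one_minus_power_nonzero[OF q(1)] qpoch_nonzero[OF q(1)]
  define d0 d1 d2 where "d0 = 1 - q * q ^ (2 * N)" and "d1 = 1 - q * q ^ (2 * N + 1)" and "d2 = 1 - q * q ^ (2 * N + 2)"
  have d: "d0 \<noteq> 0" "d1 \<noteq> 0" "d2 \<noteq> 0"
    using nz(1)[of "2 * N"] nz(1)[of "2 * N + 1"] nz(1)[of "2 * N + 2"] by (simp_all only: d0_def d1_def d2_def not_False_eq_True)
  define e where "e = 1 - q * q ^ N"
  have e: "e \<noteq> 0" using nz(1)[of N] by (simp add: e_def)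
  have PS: "?P (Suc N) = ?P N * e" "?P (2 * N + 1) = ?P (2 * N) * d0" "?P (2 * Suc N) = ?P (2 * N) * d0 * d1"
     "?P (2 * Suc N + 1) = ?P (2 * N) * d0 * d1 * d2"
    by (simp_all add: qpoch_Suc e_def d0_def d1_def d2_def)
  have reflect: "((\<lambda>j. f (- j)) has_sum S) UNIV" if "(f has_sum S) UNIV" for f :: "int \<Rightarrow> complex" and S
    using that has_sum_int_reflect[of f 0 S] by simp
  let ?S = "?P N / ?P (2 * N) * rr_sum 0 q N" and ?T = "?P N / ?P (2 * N + 1) * rr_sum 1 q N"
  have "((\<lambda>j. d0 * q ^ Suc N * bressoud_odd q N (- j) + bressoud_even q N j +
         (-1) powi j * q powi (5 * choose2 j + 3 * j) *
     (q powi (int N + 1 + 2 * j) * (qrec q (int N + 1 + 2 * j) * qrec q (int N - 1 - 2 * j))))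
      has_sum (d0 * q ^ Suc N * ?T + ?S + 0)) UNIV"
    by (intro has_sum_add has_sum_cmult_right reflect Suc.IH has_sum_0_if_odd[where c = "- 1"] bressoud_even_Suc(2,3)[OF q])
  then have "((\<lambda>j. d0 * d1 * bressoud_even q (Suc N) j) has_sum (d0 * q ^ Suc N * ?T + ?S)) UNIV"
    unfolding d0_def d1_def bressoud_even_Suc(1)[OF q] by simp
  from has_sum_cmult_right[OF this, of "1 / (d0 * d1)"]
  have "(bressoud_even q (Suc N) has_sum (1 / (d0 * d1) * (d0 * q ^ Suc N * ?T + ?S))) UNIV"
    using d by (simp add: mult.assoc[symmetric])
  also have "1 / (d0 * d1) * (d0 * q ^ Suc N * ?T + ?S) = ?P N / ?P (2 * Suc N) * (rr_sum 0 q N + q ^ Suc N * rr_sum 1 q N)"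
    unfolding PS using d nz(2)[of "2 * N"] by (simp add: field_simps)
  also have "\<dots> = ?P (Suc N) / ?P (2 * Suc N) * rr_sum 0 q (Suc N)"
    unfolding rr_sum_Suc(1)[OF q(1), symmetric] PS(1) e_def by (simp add: mult_ac)
  finally show even: "(bressoud_even q (Suc N) has_sum (?P (Suc N) / ?P (2 * Suc N) * rr_sum 0 q (Suc N))) UNIV" .
  let ?S' = "?P (Suc N) / ?P (2 * Suc N) * rr_sum 0 q (Suc N)"
  have reflect': "((\<lambda>j. bressoud_odd q N (- 1 - j)) has_sum ?T) UNIV"
    using Suc.IH(2) by (subst has_sum_int_reflect)
  have "((\<lambda>j. d1 * q ^ Suc N * bressoud_even q (Suc N) (- j) + bressoud_odd q N j + (- (q ^ Suc N)) * bressoud_odd q N (- 1 - j))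
      has_sum (d1 * q ^ Suc N * ?S' + ?T + (- (q ^ Suc N)) * ?T)) UNIV"
    by (intro has_sum_add has_sum_cmult_right reflect reflect' Suc.IH even)
  also have "(\<lambda>j. d1 * q ^ Suc N * bressoud_even q (Suc N) (- j) + bressoud_odd q N j + (- (q ^ Suc N)) * bressoud_odd q N (- 1 - j))
      = (\<lambda>j. d1 * d2 * bressoud_odd q (Suc N) j)"
    unfolding d1_def d2_def bressoud_odd_Suc[OF q] by simp
  also have "d1 * q ^ Suc N * ?S' + ?T + (- (q ^ Suc N)) * ?T = d1 * q ^ Suc N * ?S' + e * ?T"
    by (simp add: e_def left_diff_distrib diff_divide_distrib)
  finally have "((\<lambda>j. d1 * d2 * bressoud_odd q (Suc N) j) has_sum (d1 * q ^ Suc N * ?S' + e * ?T)) UNIV" .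
  from has_sum_cmult_right[OF this, of "1 / (d1 * d2)"]
  have "(bressoud_odd q (Suc N) has_sum (1 / (d1 * d2) * (d1 * q ^ Suc N * ?S' + e * ?T))) UNIV"
    using d by (simp add: mult.assoc[symmetric])
  also have "1 / (d1 * d2) * (d1 * q ^ Suc N * ?S' + e * ?T) = ?P (Suc N) / ?P (2 * Suc N + 1) * (q ^ Suc N * rr_sum 0 q (Suc N) + rr_sum 1 q N)"
    unfolding PS using d nz(2)[of "2 * N"] by (simp add: field_simps)
  also have "\<dots> = ?P (Suc N) / ?P (2 * Suc N + 1) * rr_sum 1 q (Suc N)"
    by (simp only: rr_sum_Suc(2)[OF q(1)])
  finally show "(bressoud_odd q (Suc N) has_sum (?P (Suc N) / ?P (2 * Suc N + 1) * rr_sum 1 q (Suc N))) UNIV" .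
qed

section \<open>The triple sum\<close>

lemma two_T: "2 * T j = j * j + j"
  by (simp add: T_def)

lemma qbinom_eq_qrec: "qbinom q A B = qpoch q q A * (qrec q (int B) * qrec q (int A - int B))"
  by (simp add: qbinom_def qrec_def nat_diff_distrib)

section \<open>Factoring and majorising the summands\<close>

lemma qpoch_bounded:
  assumes "norm q < 1"
  obtains D where "D > 0" "\<And>n. norm (qpoch a q n) \<le> D"
proof -
  have "Bseq (qpoch a q)"
    using qpoch_tendsto[OF assms] by (intro convergent_imp_Bseq) (auto simp: convergent_def)
  then show thesis using that by (auto simp: Bseq_def)
qed

lemma has_sum_triple_iff:
  fixes f :: "'a \<times> 'b \<times> 'c \<Rightarrow> 'd::{comm_monoid_add, topological_space}"
  shows "(f has_sum s) UNIV \<longleftrightarrow> ((\<lambda>((a, b), c). f (a, b, c)) has_sum s) UNIV"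
  by (rule has_sum_reindex_bij_witness[where j = "\<lambda>(a, b, c). ((a, b), c)" and i = "\<lambda>((a, b), c). (a, b, c)"]) auto

definition triple_term :: "complex \<Rightarrow> nat \<times> nat \<times> nat \<Rightarrow> complex" where
  "triple_term q = (\<lambda>(m, k, n).
            q ^ (2 * T k + 2 * T (m + k) + 2 * T n)
              / (qpoch q q m * qpoch q q (2 * k + 1)) * qbinom q k n)"

text \<open>The factor of the summand that involves m. Multiplied by the Bailey kernel it is exactly
  the summand of \<open>bailey_twofold\<close>.\<close>

definition pair_weight :: "complex \<Rightarrow> nat \<Rightarrow> nat \<Rightarrow> complex" where
  "pair_weight q m k = q ^ (k * k + k) * q ^ ((m + k) * (m + k) + (m + k)) * qrec q (int m)"

text \<open>Isolates the dependence on n, so that summing over n produces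
  \<open>rr_sum 1 q k\<close>.\<close>

lemma triple_term_eq:
  "triple_term q (m, k, n) = pair_weight q m k * (qrec q (int (2 * k + 1)) * qpoch q q k *
     (q ^ (n * n + 1 * n) * (qrec q (int n) * qrec q (int k - int n))))"
  unfolding triple_term_def pair_weight_def prod.case two_T qbinom_eq_qrec qrec_of_nat power_add
  by (simp add: mult_ac)

lemma norm_pair_weight_le:
  assumes "norm q < 1" "\<And>n. norm (qrec q n) \<le> C" "C > 0"
  shows "norm (pair_weight q m k) \<le> C * (norm q ^ m * norm q ^ k)"
proof -
  have "norm (q ^ ((m + k) * (m + k) + (m + k))) \<le> norm q ^ m"
    by (rule order_trans[OF norm_power_pronic_le power_decreasing]) (use assms(1) in auto)
  then have "norm (pair_weight q m k) \<le> norm q ^ k * norm q ^ m * C"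
    unfolding pair_weight_def norm_mult using assms(3)
    by (intro mult_mono norm_power_pronic_le assms mult_nonneg_nonneg) auto
  then show ?thesis by (simp add: mult_ac)
qed

lemma pair_bound_summable:
  fixes q :: complex
  assumes "norm q < 1"
  shows "(\<lambda>(m, k). norm q ^ m * norm q ^ k) summable_on (UNIV :: (nat \<times> nat) set)"
  using summable_on_times_nonneg[OF summable_on_norm_power[OF assms, of 1] summable_on_norm_power[OF assms, of 1]] by simp

lemma triple_term_summable:
  assumes q: "norm q < 1"
  shows "(\<lambda>(x, n). triple_term q (fst x, snd x, n)) summable_on UNIV \<times> UNIV"
proof -
  obtain C where C: "C > 0" "\<And>n. norm (qrec q n) \<le> C"
    using qrec_bounded[OF q] by blast
  obtain D where D: "D > 0" "\<And>n. norm (qpoch q q n) \<le> D"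
    using qpoch_bounded[OF q] by blast
  show ?thesis
  proof (rule Infinite_Sum.abs_summable_summable, rule Infinite_Sum.abs_summable_on_comparison_test')
    show "(\<lambda>(x, n). (case x of (m, k) \<Rightarrow> norm q ^ m * norm q ^ k) * (C * C * D * C * C * norm q ^ n)) summable_on UNIV \<times> UNIV"
      using C(1) D(1) by (intro summable_on_times_nonneg pair_bound_summable q summable_on_norm_power) auto
    fix y :: "(nat \<times> nat) \<times> nat"
    obtain m k n where y: "y = ((m, k), n)" by (metis prod.exhaust)
    have "norm (triple_term q (m, k, n)) \<le> C * (norm q ^ m * norm q ^ k) * (C * D * (norm q ^ n * (C * C)))"
      unfolding triple_term_eq norm_mult mult_1 using C(1) D(1)
      by (intro mult_mono norm_pair_weight_le norm_power_pronic_le C D q mult_nonneg_nonneg) auto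
    then show "norm (case y of (x, n) \<Rightarrow> triple_term q (fst x, snd x, n))
       \<le> (case y of (x, n) \<Rightarrow> (case x of (m, k) \<Rightarrow> norm q ^ m * norm q ^ k) * (C * C * D * C * C * norm q ^ n))"
      by (simp add: y mult_ac)
  qed
qed

text \<open>The bound is independent of k and is a theta term in j with parameters |q|^4 and |q|^5,
  so multiplying it by a summable weight in (m, k) gives a joint majorant.\<close>

lemma norm_bressoud_odd_le:
  assumes "q \<noteq> 0" "\<And>n. norm (qrec q n) \<le> C" "C > 0"
  shows "norm (bressoud_odd q k j) \<le> C * C * ((norm q ^ 4) powi j * (norm q ^ 5) powi choose2 j)"
proof -
  have "norm (bressoud_odd q k j) = norm q powi (5 * choose2 j + 4 * j) * (norm (qrec q (int k - 2 * j)) * norm (qrec q (int k + 2 * j + 1)))"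
    by (simp add: bressoud_odd_def norm_mult norm_power_int)
  also have "\<dots> \<le> norm q powi (5 * choose2 j + 4 * j) * (C * C)"
    using assms by (intro mult_left_mono mult_mono) auto
  also have "norm q powi (5 * choose2 j + 4 * j) = (norm q ^ 4) powi j * (norm q ^ 5) powi choose2 j"
    using assms(1) by (simp add: power_int_add power_int_power)
  finally show ?thesis by (simp add: mult_ac)
qed

text \<open>Justifies exchanging the sum over (m, k) with the sum over j.\<close>

lemma bressoud_pairs_summable:
  assumes q: "norm q < 1" "q \<noteq> 0"
  shows "(\<lambda>(x, j). pair_weight q (fst x) (snd x) * bressoud_odd q (snd x) j) summable_on UNIV \<times> UNIV"
proof -
  obtain C where C: "C > 0" "\<And>n. norm (qrec q n) \<le> C"
    using qrec_bounded[OF q(1)] by blast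
  show ?thesis
  proof (rule Infinite_Sum.abs_summable_summable, rule Infinite_Sum.abs_summable_on_comparison_test')
    have "norm q ^ 5 < 1" using q(1) by (simp add: power_less_one_iff)
    then have "(\<lambda>j. (norm q ^ 4) powi j * (norm q ^ 5) powi choose2 j) summable_on UNIV"
      using q(2) by (intro theta_summable) auto
    then show "(\<lambda>(x, j). (case x of (m, k) \<Rightarrow> norm q ^ m * norm q ^ k) * ((C * C * C) * ((norm q ^ 4) powi j * (norm q ^ 5) powi choose2 j)))
        summable_on UNIV \<times> UNIV"
      using C(1) by (intro summable_on_times_nonneg pair_bound_summable q summable_on_cmult_right) auto
    fix y :: "(nat \<times> nat) \<times> int"
    obtain m k j where y: "y = ((m, k), j)" by (metis prod.exhaust)
    have "norm (pair_weight q m k * bressoud_odd q k j)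
        \<le> C * (norm q ^ m * norm q ^ k) * (C * C * ((norm q ^ 4) powi j * (norm q ^ 5) powi choose2 j))"
      unfolding norm_mult using C(1)
      by (intro mult_mono norm_pair_weight_le norm_bressoud_odd_le C q mult_nonneg_nonneg) auto
    then show "norm (case y of (x, j) \<Rightarrow> pair_weight q (fst x) (snd x) * bressoud_odd q (snd x) j)
       \<le> (case y of (x, j) \<Rightarrow> (case x of (m, k) \<Rightarrow> norm q ^ m * norm q ^ k) * ((C * C * C) * ((norm q ^ 4) powi j * (norm q ^ 5) powi choose2 j)))"
      by (simp add: y mult_ac)
  qed
qed

lemma bressoud_pairs_has_sum:
  assumes q: "norm q < 1" "q \<noteq> 0"
  shows "((\<lambda>x. pair_weight q (fst x) (snd x) * bressoud_odd q (snd x) j)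
      has_sum ((-1) powi j * (q ^ 16) powi j * (q ^ 21) powi choose2 j / qpoch_inf q q)) UNIV"
proof -
  \<comment> \<open>\<open>bailey_twofold\<close> at r = 2 j adds 8 j * j + 4 j to the exponent,
    which equals 16 * \<open>choose2 j\<close> + 12 * j.\<close>
  have "5 * choose2 j + 4 * j + 2 * (2 * j * (2 * j) + 2 * j) = 16 * j + 21 * choose2 j"
    using two_choose2[of j] by (simp add: algebra_simps)
  then have "q powi (5 * choose2 j + 4 * j) * q powi (2 * (2 * j * (2 * j) + 2 * j)) = (q ^ 16) powi j * (q ^ 21) powi choose2 j"
    using q(2) by (simp add: power_int_power flip: power_int_add)
  then have e: "(-1) powi j * q powi (5 * choose2 j + 4 * j) * (q powi (2 * (2 * j * (2 * j) + 2 * j)) / qpoch_inf q q)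
      = (-1) powi j * (q ^ 16) powi j * (q ^ 21) powi choose2 j / qpoch_inf q q"
    by (simp add: mult.assoc)
  show ?thesis
    using has_sum_cmult_right[OF bailey_twofold[OF q(1), of "2 * j"], of "(-1) powi j * q powi (5 * choose2 j + 4 * j)"]
    unfolding e by (simp add: pair_weight_def bressoud_odd_def case_prod_unfold mult_ac)
qed

lemma triple_sum_nonzero:
  assumes q: "norm q < 1" "q \<noteq> 0"
  shows "(triple_term q has_sum (qpochs_inf [q ^ 21, q ^ 5, q ^ 16] (q ^ 21) / qpoch_inf q q)) UNIV"
proof -
  let ?L = "qpochs_inf [q ^ 21, q ^ 5, q ^ 16] (q ^ 21) / qpoch_inf q q"
  have q21: "norm (q ^ 21) < 1" "q ^ 21 \<noteq> 0" "q ^ 16 \<noteq> 0"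
    using q by (simp_all add: norm_power power_less_one_iff)
  have "q ^ 21 / q ^ 16 = q ^ 5"
    using q(2) by (simp add: power_diff[symmetric])
  then have L: "qpoch_inf (q ^ 21) (q ^ 21) * qpoch_inf (q ^ 16) (q ^ 21) * qpoch_inf (q ^ 21 / q ^ 16) (q ^ 21) * (1 / qpoch_inf q q) = ?L"
    by (simp add: qpochs_inf_def mult_ac)
  have "((\<lambda>j. (-1) powi j * (q ^ 16) powi j * (q ^ 21) powi choose2 j / qpoch_inf q q) has_sum ?L) UNIV"
    using has_sum_cmult_left[OF jacobi_triple_product[OF q21], of "1 / qpoch_inf q q"] unfolding L by simp
  \<comment> \<open>One double series is evaluated in two orders. With j outside, the inner sums are
    the Bailey sums and the outer one is Jacobi's.\<close>
  then have "((\<lambda>(j, x). pair_weight q (fst x) (snd x) * bressoud_odd q (snd x) j) has_sum ?L) (UNIV \<times> UNIV)"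
  proof (rule has_sum_SigmaI[rotated])
    show "(\<lambda>(j, x). pair_weight q (fst x) (snd x) * bressoud_odd q (snd x) j) summable_on UNIV \<times> UNIV"
      using bressoud_pairs_summable[OF q] by (subst summable_on_swap) (simp add: case_prod_unfold)
  qed (use bressoud_pairs_has_sum[OF q] in simp)
  \<comment> \<open>With (m, k) outside, the inner sum over j is Bressoud's odd identity, which
    brings back the Rogers-Ramanujan polynomial and hence the sum over n.\<close>
  then have "((\<lambda>(x, j). pair_weight q (fst x) (snd x) * bressoud_odd q (snd x) j) has_sum ?L) (UNIV \<times> UNIV)"
    by (subst has_sum_swap) (simp add: case_prod_unfold)
  then have pairs: "((\<lambda>x. pair_weight q (fst x) (snd x) * (qpoch q q (snd x) / qpoch q q (2 * snd x + 1) * rr_sum 1 q (snd x)))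
      has_sum ?L) UNIV"
    by (rule has_sum_SigmaD) (simp only: prod.case, rule has_sum_cmult_right, rule bressoud(2)[OF q])
  have "((\<lambda>(x, n). triple_term q (fst x, snd x, n)) has_sum ?L) (UNIV \<times> UNIV)"
  proof (rule has_sum_SigmaI[OF _ pairs triple_term_summable[OF q(1)]])
    fix x :: "nat \<times> nat"
    let ?k = "snd x"
    have "((\<lambda>n. q ^ (n * n + 1 * n) * (qrec q (int n) * qrec q (int ?k - int n))) has_sum rr_sum 1 q ?k) UNIV \<longleftrightarrow>
       ((\<lambda>n. q ^ (n * n + 1 * n) * (qrec q (int n) * qrec q (int ?k - int n))) has_sum rr_sum 1 q ?k) {..?k}"
      by (rule has_sum_cong_neutral) auto
    then have "((\<lambda>n. q ^ (n * n + 1 * n) * (qrec q (int n) * qrec q (int ?k - int n))) has_sum rr_sum 1 q ?k) UNIV"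
      by (auto simp: rr_sum_def intro: has_sum_finiteI)
    then have "((\<lambda>n. triple_term q (fst x, ?k, n)) has_sum
        pair_weight q (fst x) ?k * (qrec q (int (2 * ?k + 1)) * qpoch q q ?k * rr_sum 1 q ?k)) UNIV"
      unfolding triple_term_eq by (intro has_sum_cmult_right)
    then show "((\<lambda>n. case (x, n) of (x, n) \<Rightarrow> triple_term q (fst x, snd x, n)) has_sum
        pair_weight q (fst x) ?k * (qpoch q q ?k / qpoch q q (2 * ?k + 1) * rr_sum 1 q ?k)) UNIV"
      unfolding qrec_of_nat by simp
  qed
  then show ?thesis
    unfolding has_sum_triple_iff[of "triple_term q"] by (simp add: case_prod_unfold)
qed

theorem mainTheorem7:
  fixes q :: complex
  assumes "norm q < 1"
  shows "((\<lambda>(m, k, n).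
            q ^ (2 * T k + 2 * T (m + k) + 2 * T n)
              / (qpoch q q m * qpoch q q (2 * k + 1)) * qbinom q k n)
          has_sum (qpochs_inf [q ^ 21, q ^ 5, q ^ 16] (q ^ 21) / qpoch_inf q q))
         (UNIV :: (nat \<times> nat \<times> nat) set)"
proof (cases "q = 0")
  case False
  then show ?thesis
    using triple_sum_nonzero[OF assms] by (simp add: triple_term_def)
next
  \<comment> \<open>At q = 0 every Pochhammer symbol involved is 1, and the exponent k (k + 1) + (m
    + k)(m + k + 1) + n (n + 1) vanishes only at the origin, so a single term equal to 1
    remains.\<close>
  case True
  have [simp]: "qpoch 0 0 n = 1" "qpoch_inf 0 0 = 1" for n
    by (simp_all add: qpoch_def qpoch_inf_def)
  show ?thesis
  proof (rule has_sum_single[of "(0, 0, 0)"])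
    fix x :: "nat \<times> nat \<times> nat"
    assume "x \<noteq> (0, 0, 0)"
    then show "(case x of (m, k, n) \<Rightarrow> q ^ (2 * T k + 2 * T (m + k) + 2 * T n)
              / (qpoch q q m * qpoch q q (2 * k + 1)) * qbinom q k n) = 0"
      using True unfolding two_T by (cases x) (auto simp: power_0_left)
  qed (simp add: True two_T qpochs_inf_def qbinom_def)
qed

end
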